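(* Let $0<q<1$, let $a,b,c$ be real numbers with $a<b\le a+1$, and let $$g(x):=\left[\frac{1-q^{x+c}}{1-q}\right]^{a-b}\frac{\Gamma_q(x+b)}{\Gamma_q(x+a)}.$$ Then $-(\log g(x))'$ is completely monotonic on $(-c,\infty)$ if $0\le c\le (a+b-1)/2$, and $(\log g(x))'$ is completely monotonic on $(-a,\infty)$ if $c\ge a\ge 0$.
   Context: For $0<q<1$ the $q$-gamma function is $\Gamma_q(x)=(1-q)^{1-x}\prod_{n=0}^\infty \frac{1-q^{n+1}}{1-q^{n+x}}$. A function $f$ is completely monotonic on an interval $I$ if it has derivatives of all orders on $I$ and $(-1)^n f^{(n)}(x)\ge 0$ for all $x\in I$ and all $n=0,1,2,\dots$. *)

theory Defs
  imports "HOL-Analysis.Analysis"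
begin

definition q_Gamma :: "real \<Rightarrow> real \<Rightarrow> real" where
  "q_Gamma q x = (1 - q) powr (1 - x) *
     (\<Prod>n. (1 - q ^ (n + 1)) / (1 - q powr (real n + x)))"

(* D n is the n-th derivative of f on the interval I. Derivatives are taken within I, so they
   are one-sided at an endpoint belonging to I and ordinary derivatives if I is open. *)
definition completely_monotonic_on :: "real set \<Rightarrow> (real \<Rightarrow> real) \<Rightarrow> bool" where
  "completely_monotonic_on I f \<longleftrightarrow>
     (\<exists>D :: nat \<Rightarrow> real \<Rightarrow> real.
        (\<forall>x\<in>I. D 0 x = f x) \<and>
        (\<forall>n. \<forall>x\<in>I. (D n has_real_derivative D (Suc n) x) (at x within I)) \<and>
        (\<forall>n. \<forall>x\<in>I. (-1) ^ n * D n x \<ge> 0))"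

end

theory Submission
  imports Defs
begin

text \<open>
  Expanding the logarithms, \<open>ln (g x)\<close> is a power series in \<open>q powr x\<close> whose \<open>k\<close>-th coefficient is,
  with \<open>t = q ^ k\<close>, equal to \<open>((b - a) * t powr c - (t powr a - t powr b) / (1 - t)) / k\<close>.
  Differentiating in \<open>x\<close> multiplies the \<open>k\<close>-th term by \<open>k * ln q\<close>, which is nonpositive, so a power
  series in \<open>q powr x\<close> with nonnegative coefficients is completely monotonic and everything reduces to
  the signs of the coefficients. With \<open>t = exp (- 2 * u)\<close> the first sign is
  \<open>sinh ((b - a) * u) \<le> (b - a) * sinh u\<close>, i.e. convexity of \<open>sinh\<close>; the second is Bernoulli's inequality.
\<close>

section \<open>Elementary inequalities between powers of \<open>t\<close>\<close>

lemma sinh_mult_le: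
  fixes s u :: real
  assumes "0 \<le> s" "s \<le> 1" "0 \<le> u"
  shows "sinh (s * u) \<le> s * sinh u"
proof -
  have "convex_on {0..} (sinh :: real \<Rightarrow> real)"
  proof (rule f''_ge0_imp_convex)
    show "(sinh has_real_derivative cosh x) (at x)" for x :: real
      by (auto intro!: derivative_eq_intros)
    show "(cosh has_real_derivative sinh x) (at x)" for x :: real
      by (auto intro!: derivative_eq_intros)
  qed auto
  from convex_onD[OF this, of s 0 u] show ?thesis
    using assms by simp
qed

text \<open>Factoring out the geometric mean of \<open>t powr a\<close> and \<open>t powr b\<close>
  turns their difference into a \<open>sinh\<close>, while \<open>1 - t\<close> is
  \<open>t powr (1/2)\<close> times \<open>2 * sinh u\<close>. This gives the bound with exponent
  \<open>(a + b - 1) / 2\<close>; lowering the exponent to \<open>c\<close> only enlarges it, as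
  \<open>t < 1\<close>.\<close>

lemma powr_diff_le:
  fixes t a b c :: real
  assumes t: "0 < t" "t < 1" and ab: "a < b" "b \<le> a + 1" and c: "c \<le> (a + b - 1) / 2"
  shows "t powr a - t powr b \<le> (b - a) * (1 - t) * t powr c"
proof -
  define u where "u = - ln t / 2"
  have u: "u > 0" and powr_t: "t powr y = exp (- 2 * u * y)" for y
    using t by (auto simp: u_def powr_def)
  have two_sinh: "2 * sinh x = exp x - exp (- x)" for x :: real
    by (simp add: sinh_field_def)
  have t_eq: "t = exp (- 2 * u)"
    using powr_t[of 1] t by simp
  have "t powr a - t powr b = exp (- u * (a + b)) * (2 * sinh ((b - a) * u))"
  proof -
    have "t powr a = exp (- u * (a + b)) * exp ((b - a) * u)"
      "t powr b = exp (- u * (a + b)) * exp (- ((b - a) * u))"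
      by (simp_all add: powr_t algebra_simps flip: exp_add)
    then show ?thesis
      by (simp only: two_sinh right_diff_distrib)
  qed
  also have "\<dots> \<le> exp (- u * (a + b)) * (2 * ((b - a) * sinh u))"
    using sinh_mult_le[of "b - a" u] ab u by simp
  also have "\<dots> = (b - a) * (1 - t) * t powr ((a + b - 1) / 2)"
  proof -
    have "1 - t = exp (- u) * (2 * sinh u)"
      by (simp add: t_eq two_sinh right_diff_distrib flip: exp_add)
    moreover have "t powr ((a + b - 1) / 2) = exp (- u * (a + b)) * exp u"
      by (simp add: powr_t flip: exp_add) (simp add: algebra_simps)
    ultimately have "(b - a) * (1 - t) * t powr ((a + b - 1) / 2)
        = exp (- u * (a + b)) * (2 * ((b - a) * sinh u)) * (exp (- u) * exp u)"
      by (simp only: mult_ac)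
    moreover have "exp (- u) * exp u = 1"
      by (simp flip: exp_add)
    ultimately show ?thesis by (simp only: mult_1_right)
  qed
  also have "\<dots> \<le> (b - a) * (1 - t) * t powr c"
    using t ab c by (intro mult_left_mono powr_mono') auto
  finally show ?thesis .
qed

lemma powr_diff_ge:
  fixes t a b c :: real
  assumes t: "0 < t" "t < 1" and ab: "a < b" "b \<le> a + 1" and c: "a \<le> c"
  shows "(b - a) * (1 - t) * t powr c \<le> t powr a - t powr b"
proof -
  have "(b - a) * (1 - t) * t powr c \<le> (b - a) * (1 - t) * t powr a"
    using t ab c by (intro mult_left_mono powr_mono') auto
  \<comment> \<open>With weights \<open>b - a\<close> and \<open>1 - (b - a)\<close> on
    \<open>t\<close> and \<open>1\<close>, Young's inequality is Bernoulli's
    \<open>t powr (b - a) \<le> 1 - (b - a) * (1 - t)\<close>.\<close>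
  also have "\<dots> \<le> (1 - t powr (b - a)) * t powr a"
    using Youngs_inequality_0[of "b - a" "1 - (b - a)" t 1] t ab
    by (intro mult_right_mono) (auto simp: algebra_simps)
  also have "\<dots> = t powr a - t powr b"
    by (simp add: left_diff_distrib flip: powr_add)
  finally show ?thesis .
qed

section \<open>Power series in \<open>q powr x\<close> and complete monotonicity\<close>

text \<open>The Euler operator z d/dz: \<open>diffs\<close> shifts the index down by one and the
  factor \<open>z\<close> restores it.\<close>

lemma powser_times_index:
  fixes w :: "nat \<Rightarrow> real"
  assumes "\<And>z. \<bar>z\<bar> < R \<Longrightarrow> summable (\<lambda>k. w k * z ^ k)" and "\<bar>z\<bar> < R"
  shows "(\<lambda>k. (real k * w k) * z ^ k) sums (z * (\<Sum>k. diffs w k * z ^ k))"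
proof -
  have "summable (\<lambda>k. diffs w k * z ^ k)"
    using termdiff_converges[of z R w] assms by simp
  then have "(\<lambda>k. z * (diffs w k * z ^ k)) sums (z * (\<Sum>k. diffs w k * z ^ k))"
    by (intro sums_mult summable_sums)
  then have "(\<lambda>k. real (Suc k) * w (Suc k) * z ^ Suc k) sums (z * (\<Sum>k. diffs w k * z ^ k))"
    by (simp add: diffs_def mult.commute mult.left_commute del: of_nat_Suc)
  from sums_Suc[OF this] show ?thesis by simp
qed

text \<open>By the chain rule, d/dx acts as \<open>ln q\<close> times the Euler operator, so the
  result is again a power series in \<open>q powr x\<close> and differentiation can be
  iterated.\<close>

lemma has_real_derivative_powser_powr:
  fixes w :: "nat \<Rightarrow> real" and q :: real
  assumes "0 < q" and "\<And>z. \<bar>z\<bar> < R \<Longrightarrow> summable (\<lambda>k. w k * z ^ k)" and "q powr x < R"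
  shows "((\<lambda>x. \<Sum>k. w k * (q powr x) ^ k) has_real_derivative
           (\<Sum>k. (ln q * (real k * w k)) * (q powr x) ^ k)) (at x)"
proof -
  let ?z = "q powr x"
  have "((\<lambda>x. q powr x) has_real_derivative ln q * ?z) (at x)"
    using assms(1) by (auto intro!: derivative_eq_intros)
  moreover have "((\<lambda>z. \<Sum>k. w k * z ^ k) has_real_derivative (\<Sum>k. diffs w k * ?z ^ k)) (at ?z)"
    using termdiffs_strong'[of R w ?z] assms by simp
  ultimately have "((\<lambda>x. \<Sum>k. w k * (q powr x) ^ k) has_real_derivative
      (\<Sum>k. diffs w k * ?z ^ k) * (ln q * ?z)) (at x)"
    by (rule DERIV_chain2[rotated])
  moreover have "(\<Sum>k. (ln q * (real k * w k)) * ?z ^ k) = (\<Sum>k. diffs w k * ?z ^ k) * (ln q * ?z)"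
    using sums_unique[OF sums_mult[OF powser_times_index[of R w ?z], of "ln q"]] assms
    by (simp add: mult_ac)
  ultimately show ?thesis by simp
qed

lemma completely_monotonic_on_powser_powr:
  fixes w :: "nat \<Rightarrow> real" and q :: real
  assumes q: "0 < q" "q \<le> 1"
    and sm: "\<And>z. \<bar>z\<bar> < R \<Longrightarrow> summable (\<lambda>k. w k * z ^ k)"
    and nonneg: "\<And>k. 0 \<le> w k"
    and R: "\<And>x. x \<in> I \<Longrightarrow> q powr x < R"
    and f: "\<And>x. x \<in> I \<Longrightarrow> f x = (\<Sum>k. w k * (q powr x) ^ k)"
  shows "completely_monotonic_on I f"
proof -
  define c where "c n k = (ln q * real k) ^ n * w k" for n k
  define D where "D n x = (\<Sum>k. c n k * (q powr x) ^ k)" for n x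
  have c_Suc: "c (Suc n) k = ln q * (real k * c n k)" for n k
    by (simp add: c_def mult_ac)
  \<comment> \<open>Termwise differentiation of \<open>D n\<close> requires convergence on the whole
    disc, not only at the points \<open>q powr x\<close>.\<close>
  have c_summable: "\<bar>z\<bar> < R \<Longrightarrow> summable (\<lambda>k. c n k * z ^ k)" for n z
  proof (induction n arbitrary: z)
    case 0
    then show ?case using sm by (simp add: c_def)
  next
    case (Suc n)
    then show ?case
      using sums_summable[OF sums_mult[OF powser_times_index[of R "c n" z], of "ln q"]]
      by (simp add: c_Suc mult_ac)
  qed
  show ?thesis
    unfolding completely_monotonic_on_def
  proof (intro exI[of _ D] conjI ballI allI)
    fix x n assume x: "x \<in> I"
    show "D 0 x = f x" using f[OF x] by (simp add: D_def c_def)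
    show "(D n has_real_derivative D (Suc n) x) (at x within I)"
      using has_real_derivative_powser_powr[OF q(1) c_summable R[OF x], of n]
      unfolding D_def c_Suc by (rule has_field_derivative_at_within)
    have nonneg': "0 \<le> (- 1) ^ n * (c n k * (q powr x) ^ k)" for k
    proof -
      have "0 \<le> (- ln q * real k) ^ n * w k * (q powr x) ^ k"
        using q nonneg by (intro mult_nonneg_nonneg zero_le_power) auto
      also have "\<dots> = (- 1) ^ n * (c n k * (q powr x) ^ k)"
        by (simp add: c_def mult_ac flip: power_mult_distrib)
      finally show ?thesis .
    qed
    have sm': "summable (\<lambda>k. c n k * (q powr x) ^ k)"
      using R[OF x] by (intro c_summable) simp
    show "(- 1) ^ n * D n x \<ge> 0"
      unfolding D_def suminf_mult[OF sm', symmetric]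
      by (intro suminf_nonneg summable_mult sm' nonneg')
  qed
qed

section \<open>Logarithms of q-Pochhammer products and of the q-gamma function\<close>

lemma sums_minus_ln:
  fixes z :: real
  assumes "\<bar>z\<bar> < 1"
  shows "(\<lambda>k. z ^ k / real k) sums (- ln (1 - z))"
  using sums_minus[OF ln_series'[of "- z"]] assms by simp

text \<open>For \<open>\<bar>z\<bar> < 1\<close> this is minus the logarithm of the infinite product
  of the factors \<open>1 - z * q ^ n\<close>. The term at \<open>k = 0\<close> vanishes because
  division by zero gives zero.\<close>

definition q_log_series :: "real \<Rightarrow> real \<Rightarrow> real" where
  "q_log_series q z = (\<Sum>k. 1 / (real k * (1 - q ^ k)) * z ^ k)"

lemma summable_q_log_series:
  fixes q z :: real
  assumes q: "0 < q" "q < 1" and z: "\<bar>z\<bar> < 1"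
  shows "summable (\<lambda>k. 1 / (real k * (1 - q ^ k)) * z ^ k)"
proof (rule summable_comparison_test')
  show "summable (\<lambda>k. 1 / (1 - q) * \<bar>z\<bar> ^ k)"
    using z by (intro summable_mult summable_geometric) simp
  show "norm (1 / (real k * (1 - q ^ k)) * z ^ k) \<le> 1 / (1 - q) * \<bar>z\<bar> ^ k" if "k \<ge> 1" for k
  proof -
    have "q ^ k \<le> q"
      using power_decreasing[of 1 k q] that q by simp
    then have "1 * (1 - q) \<le> real k * (1 - q ^ k)"
      using that q by (intro mult_mono) auto
    then have "1 / (real k * (1 - q ^ k)) \<le> 1 / (1 - q)"
      using q that by (intro divide_left_mono mult_pos_pos) (auto simp: power_less_one_iff)
    then have "1 / (real k * (1 - q ^ k)) * \<bar>z\<bar> ^ k \<le> 1 / (1 - q) * \<bar>z\<bar> ^ k"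
      by (rule mult_right_mono) simp
    then show ?thesis
      using q by (simp add: abs_mult power_abs power_le_one)
  qed
qed

text \<open>Since \<open>q_log_series q z - q_log_series q (q z) = - ln (1 - z)\<close>, the sum telescopes.\<close>

lemma sums_ln_q_Pochhammer:
  fixes q z :: real
  assumes q: "0 < q" "q < 1" and z: "\<bar>z\<bar> < 1"
  shows "(\<lambda>n. ln (1 - z * q ^ n)) sums (- q_log_series q z)"
proof -
  let ?L = "q_log_series q"
  have step: "?L (y * q) - ?L y = ln (1 - y)" if y: "\<bar>y\<bar> < 1" for y
  proof -
    have "\<bar>y * q\<bar> < 1"
      using y q mult_strict_mono'[of "\<bar>y\<bar>" 1 q 1] by (simp add: abs_mult)
    then have "(\<lambda>k. 1 / (real k * (1 - q ^ k)) * y ^ k - 1 / (real k * (1 - q ^ k)) * (y * q) ^ k)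
        sums (?L y - ?L (y * q))"
      unfolding q_log_series_def using y
      by (intro sums_diff summable_sums summable_q_log_series q)
    moreover have "1 / (real k * (1 - q ^ k)) * y ^ k - 1 / (real k * (1 - q ^ k)) * (y * q) ^ k
        = y ^ k / real k" for k
    proof (cases "k = 0")
      case False
      define d where "d = 1 - q ^ k"
      have "q ^ k = 1 - d" "d \<noteq> 0"
        using q False power_strict_decreasing[of 0 k q] by (auto simp: d_def)
      then show ?thesis
        using False by (simp only: power_mult_distrib) (simp add: field_simps)
    qed simp
    ultimately have "(\<lambda>k. y ^ k / real k) sums (?L y - ?L (y * q))" by simp
    from sums_unique2[OF this sums_minus_ln[OF y]] show ?thesis by simp
  qed
  \<comment> \<open>The telescoped partial sums are \<open>?L (z * q ^ n) - ?L z\<close>; continuity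
    at 0 sends the first term to \<open>?L 0 = 0\<close>.\<close>
  have "(\<lambda>n. z * q ^ n) \<longlonglongrightarrow> 0"
    using q by (intro tendsto_mult_right_zero LIMSEQ_realpow_zero) auto
  moreover have "isCont ?L 0"
    unfolding q_log_series_def
    using termdiffs_strong'[of 1 "\<lambda>k. 1 / (real k * (1 - q ^ k))" 0] summable_q_log_series[OF q]
    by (intro DERIV_isCont) auto
  ultimately have "(\<lambda>n. ?L (z * q ^ n)) \<longlonglongrightarrow> ?L 0"
    by (rule isCont_tendsto_compose[rotated])
  moreover have "?L 0 = 0"
    unfolding q_log_series_def by (subst powser_zero) simp
  ultimately have "(\<lambda>n. ?L (z * q ^ Suc n) - ?L (z * q ^ n)) sums (- ?L z)"
    using telescope_sums[of "\<lambda>n. ?L (z * q ^ n)" 0] by simp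
  moreover have "?L (z * q ^ Suc n) - ?L (z * q ^ n) = ln (1 - z * q ^ n)" for n
  proof -
    have "\<bar>z * q ^ n\<bar> \<le> \<bar>z\<bar>"
      using q by (simp add: abs_mult mult_left_le power_le_one)
    then show ?thesis
      using step[of "z * q ^ n"] z by (simp add: mult_ac)
  qed
  ultimately show ?thesis by simp
qed

lemma q_Gamma_eq_exp:
  fixes q y :: real
  assumes q: "0 < q" "q < 1" and y: "y > 0"
  shows "q_Gamma q y = exp ((1 - y) * ln (1 - q) + q_log_series q (q powr y) - q_log_series q q)"
proof -
  have qy: "q powr y < 1" using q y powr_less_mono'[of q 0 y] by simp
  have *: "1 - z * q ^ n > 0" if "0 < z" "z < 1" for z n
  proof -
    have "z * q ^ n \<le> z"
      using that q by (intro mult_left_le power_le_one) auto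
    then show ?thesis using that by linarith
  qed
  \<comment> \<open>The numerators form the product at \<open>z = q\<close>, which absorbs the shift
    \<open>n + 1\<close>; the denominators form the one at \<open>z = q powr y\<close>.\<close>
  define h where "h n = ln (1 - q * q ^ n) - ln (1 - q powr y * q ^ n)" for n :: nat
  have h: "h sums (- q_log_series q q - - q_log_series q (q powr y))"
    unfolding h_def using q qy by (intro sums_diff sums_ln_q_Pochhammer) auto
  have "(1 - q ^ (n + 1)) / (1 - q powr (real n + y)) = exp (h n)" for n
    using *[of q n] *[of "q powr y" n] q qy
    by (simp add: h_def exp_diff powr_add powr_realpow mult_ac)
  then have "(\<Prod>n. (1 - q ^ (n + 1)) / (1 - q powr (real n + y))) = exp (suminf h)"
    using prodinf_exp[OF sums_summable[OF h]] by simp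
  then show ?thesis
    using q sums_unique[OF h] by (simp add: q_Gamma_def powr_def exp_add exp_diff exp_minus field_simps)
qed

section \<open>Expansion of \<open>ln (g x)\<close> and the signs of its coefficients\<close>

definition log_ratio_coeff :: "real \<Rightarrow> real \<Rightarrow> real \<Rightarrow> real \<Rightarrow> nat \<Rightarrow> real" where
  "log_ratio_coeff q a b c k =
     ((b - a) * (q powr c) ^ k - ((q powr a) ^ k - (q powr b) ^ k) / (1 - q ^ k)) / real k"

text \<open>Allowing general \<open>z\<close> instead of only \<open>q powr x\<close> provides the
  convergence on a disc that termwise differentiation requires.\<close>

lemma log_ratio_sums:
  fixes q a b c z :: real
  assumes q: "0 < q" "q < 1" and z: "\<bar>q powr a * z\<bar> < 1" "\<bar>q powr b * z\<bar> < 1" "\<bar>q powr c * z\<bar> < 1"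
  shows "(\<lambda>k. log_ratio_coeff q a b c k * z ^ k) sums
    ((a - b) * ln (1 - q powr c * z) + q_log_series q (q powr b * z) - q_log_series q (q powr a * z))"
proof -
  let ?l = "\<lambda>k. 1 / (real k * (1 - q ^ k))"
  have "(\<lambda>k. (b - a) * ((q powr c * z) ^ k / real k) + ?l k * (q powr b * z) ^ k - ?l k * (q powr a * z) ^ k)
      sums ((b - a) * (- ln (1 - q powr c * z)) + q_log_series q (q powr b * z) - q_log_series q (q powr a * z))"
    unfolding q_log_series_def using z
    by (intro sums_diff sums_add sums_mult sums_minus_ln summable_sums summable_q_log_series q)
  moreover have "(b - a) * ((q powr c * z) ^ k / real k) + ?l k * (q powr b * z) ^ k - ?l k * (q powr a * z) ^ k
      = log_ratio_coeff q a b c k * z ^ k" for k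
    by (simp add: log_ratio_coeff_def power_mult_distrib diff_divide_distrib add_divide_distrib algebra_simps)
  ultimately show ?thesis by (simp add: algebra_simps)
qed

text \<open>The powers of \<open>1 - q\<close> cancel: exponent \<open>- (a - b)\<close> from the
  bracket against \<open>(1 - (x + b)) - (1 - (x + a))\<close> from the quotient. The constant
  \<open>q_log_series q q\<close> cancels too.\<close>

lemma ln_q_Gamma_ratio:
  fixes q a b c x :: real
  assumes q: "0 < q" "q < 1" and x: "x + a > 0" "x + b > 0" "x + c > 0"
  shows "ln (((1 - q powr (x + c)) / (1 - q)) powr (a - b) * (q_Gamma q (x + b) / q_Gamma q (x + a)))
    = (\<Sum>k. log_ratio_coeff q a b c k * (q powr x) ^ k)"
proof -
  have less: "q powr (x + y) < 1" if "x + y > 0" for y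
    using q that powr_less_mono'[of q 0 "x + y"] by simp
  have comm: "q powr y * q powr x = q powr (x + y)" for y
    by (simp add: powr_add)
  have "((1 - q powr (x + c)) / (1 - q)) powr (a - b) * (q_Gamma q (x + b) / q_Gamma q (x + a))
    = exp ((a - b) * ln (1 - q powr (x + c)) + q_log_series q (q powr (x + b)) - q_log_series q (q powr (x + a)))"
    using q less[OF x(3)] x
    by (simp add: q_Gamma_eq_exp powr_def[of "_ / _"] ln_div flip: exp_diff exp_add)
       (simp add: algebra_simps)
  moreover have "(\<lambda>k. log_ratio_coeff q a b c k * (q powr x) ^ k) sums
    ((a - b) * ln (1 - q powr (x + c)) + q_log_series q (q powr (x + b)) - q_log_series q (q powr (x + a)))"
    using log_ratio_sums[of q a "q powr x" b c] q less x by (simp add: comm)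
  ultimately show ?thesis using sums_unique by fastforce
qed

text \<open>For \<open>k \<noteq> 0\<close>, put \<open>t = q ^ k\<close> and multiply by
  \<open>1 - t > 0\<close>: the signs become \<open>powr_diff_le\<close> and
  \<open>powr_diff_ge\<close>. The coefficient at \<open>k = 0\<close> is a division by zero, hence
  zero.\<close>

lemma log_ratio_coeff_sign:
  fixes q a b c :: real
  assumes q: "0 < q" "q < 1" and ab: "a < b" "b \<le> a + 1"
  shows "c \<le> (a + b - 1) / 2 \<Longrightarrow> 0 \<le> log_ratio_coeff q a b c k"
    and "a \<le> c \<Longrightarrow> log_ratio_coeff q a b c k \<le> 0"
proof -
  have swap: "(q powr y) ^ k = (q ^ k) powr y" for y
    using q by (simp add: powr_power powr_powr mult.commute flip: powr_realpow)
  have t: "0 < q ^ k" "q ^ k < 1" if "k \<noteq> 0"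
    using q that by (auto simp: power_less_one_iff)
  show "0 \<le> log_ratio_coeff q a b c k" if "c \<le> (a + b - 1) / 2"
  proof (cases "k = 0")
    case False
    then show ?thesis using powr_diff_le[OF t[OF False] ab that] t[OF False]
      by (simp add: log_ratio_coeff_def swap pos_divide_le_eq mult_ac)
  qed (simp add: log_ratio_coeff_def)
  show "log_ratio_coeff q a b c k \<le> 0" if "a \<le> c"
  proof (cases "k = 0")
    case False
    then show ?thesis using powr_diff_ge[OF t[OF False] ab that] t[OF False]
      by (simp add: log_ratio_coeff_def swap pos_le_divide_eq mult_ac divide_le_0_iff)
  qed (simp add: log_ratio_coeff_def)
qed

theorem theorem2p5:
  fixes q a b c :: real and g :: "real \<Rightarrow> real"
  assumes "0 < q" and "q < 1"
    and "a < b" and "b \<le> a + 1"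
    and "\<And>x. g x = ((1 - q powr (x + c)) / (1 - q)) powr (a - b)
                      * (q_Gamma q (x + b) / q_Gamma q (x + a))"
  shows "(0 \<le> c \<and> c \<le> (a + b - 1) / 2 \<longrightarrow>
            completely_monotonic_on {- c<..} (\<lambda>x. - deriv (\<lambda>y. ln (g y)) x))
       \<and> (c \<ge> a \<and> a \<ge> 0 \<longrightarrow>
            completely_monotonic_on {- a<..} (deriv (\<lambda>y. ln (g y))))"
proof -
  note q = assms(1,2) and ab = assms(3,4)
  let ?v = "log_ratio_coeff q a b c"
  \<comment> \<open>Below, \<open>m\<close> is the smaller of \<open>a\<close> and \<open>c\<close>:
    \<open>c\<close> in the first claim, \<open>a\<close> in the second. Since \<open>a < b\<close>,
    the disc of radius \<open>q powr (- m)\<close> suits all three series, and it contains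
    \<open>q powr x\<close> for \<open>x > - m\<close>.\<close>
  have v_summable: "summable (\<lambda>k. ?v k * z ^ k)" and v'_summable: "summable (\<lambda>k. (real k * ?v k) * z ^ k)"
    if m: "m \<le> a" "m \<le> c" and z: "\<bar>z\<bar> < q powr (- m)" for m z
  proof -
    have *: "summable (\<lambda>k. ?v k * y ^ k)" if y: "\<bar>y\<bar> < q powr (- m)" for y
    proof (intro sums_summable[OF log_ratio_sums] q)
      have "\<bar>q powr d * y\<bar> < 1" if "m \<le> d" for d
      proof -
        have "\<bar>q powr d * y\<bar> < q powr d * q powr (- m)"
          using y q by (simp add: abs_mult)
        also have "\<dots> \<le> 1"
          using q that by (simp add: powr_le1 flip: powr_add)
        finally show ?thesis .
      qed
      then show "\<bar>q powr a * y\<bar> < 1" "\<bar>q powr b * y\<bar> < 1" "\<bar>q powr c * y\<bar> < 1"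
        using m ab by auto
    qed
    show "summable (\<lambda>k. ?v k * z ^ k)" using *[OF z] .
    show "summable (\<lambda>k. (real k * ?v k) * z ^ k)"
      using powser_times_index[OF * z] by (rule sums_summable)
  qed
  have deriv_ln_g: "deriv (\<lambda>y. ln (g y)) x = (\<Sum>k. (ln q * (real k * ?v k)) * (q powr x) ^ k)"
    if m: "m \<le> a" "m \<le> c" and x: "x \<in> {- m<..}" for m x
  proof (rule DERIV_imp_deriv)
    have "((\<lambda>x. \<Sum>k. ?v k * (q powr x) ^ k) has_real_derivative
        (\<Sum>k. (ln q * (real k * ?v k)) * (q powr x) ^ k)) (at x)"
      using has_real_derivative_powser_powr[OF q(1), of "q powr (- m)" ?v x] v_summable[OF m]
        powr_less_mono'[of q "- m" x] x q
      by simp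
    \<comment> \<open>The series represents \<open>ln (g y)\<close> on \<open>{- m<..}\<close>, an
      open neighbourhood of \<open>x\<close>, so the derivative carries over.\<close>
    then show "((\<lambda>y. ln (g y)) has_real_derivative
        (\<Sum>k. (ln q * (real k * ?v k)) * (q powr x) ^ k)) (at x)"
    proof (rule has_field_derivative_transform_within_open)
      show "open {- m<..}" by simp
      show "(\<Sum>k. ?v k * (q powr y) ^ k) = ln (g y)" if "y \<in> {- m<..}" for y
        using that m ab ln_q_Gamma_ratio[OF q, of y a b c] by (simp add: assms(5))
    qed (fact x)
  qed
  show ?thesis
  proof (intro conjI impI; elim conjE)
    assume c: "0 \<le> c" "c \<le> (a + b - 1) / 2"
    \<comment> \<open>Here \<open>b \<le> a + 1\<close> gives
      \<open>(a + b - 1) / 2 \<le> a\<close>.\<close>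
    then have m: "c \<le> a" "c \<le> c" using ab by auto
    show "completely_monotonic_on {- c<..} (\<lambda>x. - deriv (\<lambda>y. ln (g y)) x)"
    proof (rule completely_monotonic_on_powser_powr)
      show "summable (\<lambda>k. (- ln q * (real k * ?v k)) * z ^ k)" if "\<bar>z\<bar> < q powr (- c)" for z
        using summable_mult[OF v'_summable[OF m that], of "- ln q"] by (simp add: mult_ac)
      show "0 \<le> - ln q * (real k * ?v k)" for k
        using log_ratio_coeff_sign(1)[OF q ab c(2)] q by (intro mult_nonneg_nonneg) auto
      fix x assume x: "x \<in> {- c<..}"
      then show *: "q powr x < q powr (- c)" using q powr_less_mono'[of q "- c" x] by simp
      then show "- deriv (\<lambda>y. ln (g y)) x = (\<Sum>k. (- ln q * (real k * ?v k)) * (q powr x) ^ k)"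
        using suminf_minus[OF summable_mult[OF v'_summable[OF m], of "q powr x" "ln q"]]
        by (simp add: deriv_ln_g[OF m x] mult_ac)
    qed (use q in auto)
  next
    assume c: "c \<ge> a" "a \<ge> 0"
    then have m: "a \<le> a" "a \<le> c" by auto
    show "completely_monotonic_on {- a<..} (deriv (\<lambda>y. ln (g y)))"
    proof (rule completely_monotonic_on_powser_powr)
      show "summable (\<lambda>k. (ln q * (real k * ?v k)) * z ^ k)" if "\<bar>z\<bar> < q powr (- a)" for z
        using summable_mult[OF v'_summable[OF m that], of "ln q"] by (simp add: mult_ac)
      \<comment> \<open>Both \<open>ln q\<close> and \<open>?v k\<close> are nonpositive now, so the
        derivative itself, not its negative, has nonnegative coefficients.\<close>
      show "0 \<le> ln q * (real k * ?v k)" for k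
        using log_ratio_coeff_sign(2)[OF q ab c(1)] q
        by (intro mult_nonpos_nonpos mult_nonneg_nonpos) auto
      fix x assume x: "x \<in> {- a<..}"
      then show "q powr x < q powr (- a)" using q powr_less_mono'[of q "- a" x] by simp
      show "deriv (\<lambda>y. ln (g y)) x = (\<Sum>k. (ln q * (real k * ?v k)) * (q powr x) ^ k)"
        by (rule deriv_ln_g[OF m x])
    qed (use q in auto)
  qed
qed

end
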